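(* Consider an arbitrary instance of the CAPCAB. There exists an optimal solution for this instance in which the (optimal) compensation values $C_{ij}^*$ are equal to $$C^*_{ij} = \operatorname{argmin}_{C_{ij}\ge 0}\; P_{ij}(C_{ij})(C_{ij}-c'_i)$$ if task $i\in I$ is offered to occasional driver $j\in J$. Furthermore, compensations $C_{ij}^*$ for tasks $i\in I$ that are not offered to occasional driver $j\in J$ can be set to an arbitrary (non-negative) value.
   Context: An instance of the Crowdshipping Assignment Problem with Compensation-Driven Acceptance Behavior (CAPCAB) consists of a finite set $I$ of tasks, a finite set $J$ of occasional drivers, costs $c_i'\ge c_i\ge 0$ for each $i\in I$ ($c_i$ is the cost of having task $i$ performed by a professional driver, $c_i'$ the penalized cost incurred if task $i$ is refused by an occasional driver), and, for each $i\in I$, $j\in J$, an acceptance probability function $P_{ij}:[0,\infty)\to[0,1]$ with $P_{ij}(0)=0$, where $P_{ij}(C_{ij})$ is the probability that driver $j$ accepts task $i$ when offered compensation $C_{ij}$. The functions are separable: the probability that $j$ accepts $i$ does not depend on other tasks, on compensations offered to other drivers, or on other drivers' acceptance decisions. A feasible solution consists of a one-to-one assignment $A\subseteq I\times J$ of offered pairs (each task and each driver occurs in at most one pair of $A$; task $i$ is offered to driver $j$ iff $(i,j)\in A$) and compensations $C_{ij}\ge 0$. There are no further constraints on the operator's choice. Let $I_{\mathrm o}=\{i : (i,j)\in A \text{ for some } j\}$; tasks in $I\setminus I_{\mathrm o}$ are performed by professional drivers. The expected total cost of the solution is $$\sum_{i\in I\setminus I_{\mathrm o}} c_i+\sum_{(i,j)\in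 A}\bigl(P_{ij}(C_{ij})\,C_{ij}+(1-P_{ij}(C_{ij}))\,c_i'\bigr).$$ An optimal solution is a feasible solution of minimum expected total cost.
   Formalization: The formal theorem assumes that for every task i and driver j the minimum of P_ij(C)(C − c'_i) over C ≥ 0 is attained; without this an arbitrary instance may have no optimal solution (e.g. c = c' = 10, P = 0 up to 1 and P = 1 beyond). *)

theory Defs
  imports Complex_Main
begin

text \<open>
  An instance of the crowdshipping assignment problem with compensation-driven acceptance
  behaviour: tasks \<open>I\<close>, occasional drivers \<open>J\<close>, professional costs \<open>c\<close>, penalized costs \<open>c'\<close>.
  \<open>P i j x\<close> is the probability that driver \<open>j\<close> accepts task \<open>i\<close> for compensation \<open>x\<close>; it is
  meaningful for \<open>x \<ge> 0\<close> only, so nothing is assumed about its values at negative \<open>x\<close>.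
\<close>

locale capcab =
  fixes I :: "'i set" and J :: "'j set"
    and c c' :: "'i \<Rightarrow> real"
    and P :: "'i \<Rightarrow> 'j \<Rightarrow> real \<Rightarrow> real"
  assumes finite_I: "finite I" and finite_J: "finite J"
    and c_nonneg: "i \<in> I \<Longrightarrow> 0 \<le> c i"
    and c_le_c': "i \<in> I \<Longrightarrow> c i \<le> c' i"
    and P_prob: "i \<in> I \<Longrightarrow> j \<in> J \<Longrightarrow> 0 \<le> x \<Longrightarrow> P i j x \<in> {0..1}"
    and P_zero: "i \<in> I \<Longrightarrow> j \<in> J \<Longrightarrow> P i j 0 = 0"
begin

text \<open>A solution is a pair of a set \<open>A\<close> of offered pairs and a table \<open>C\<close> of compensations, of
  which only the entries in \<open>I \<times> J\<close> matter.\<close>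

definition assignment :: "('i \<times> 'j) set \<Rightarrow> bool" where
  "assignment A \<longleftrightarrow> A \<subseteq> I \<times> J \<and> inj_on fst A \<and> inj_on snd A"

definition compensation :: "('i \<Rightarrow> 'j \<Rightarrow> real) \<Rightarrow> bool" where
  "compensation C \<longleftrightarrow> (\<forall>i\<in>I. \<forall>j\<in>J. 0 \<le> C i j)"

definition feasible :: "('i \<times> 'j) set \<Rightarrow> ('i \<Rightarrow> 'j \<Rightarrow> real) \<Rightarrow> bool" where
  "feasible A C \<longleftrightarrow> assignment A \<and> compensation C"

definition expected_cost :: "('i \<times> 'j) set \<Rightarrow> ('i \<Rightarrow> 'j \<Rightarrow> real) \<Rightarrow> real" where
  "expected_cost A C =
     (\<Sum>i\<in>I - fst ` A. c i) +
     (\<Sum>(i, j)\<in>A. P i j (C i j) * C i j + (1 - P i j (C i j)) * c' i)"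

definition optimal :: "('i \<times> 'j) set \<Rightarrow> ('i \<Rightarrow> 'j \<Rightarrow> real) \<Rightarrow> bool" where
  "optimal A C \<longleftrightarrow> feasible A C \<and>
     (\<forall>A' C'. feasible A' C' \<longrightarrow> expected_cost A C \<le> expected_cost A' C')"

text \<open>Minimizers need be neither unique nor, since \<open>P i j\<close> is not assumed continuous, existent;
  hence a predicate rather than a value.\<close>

definition argmin_compensation :: "'i \<Rightarrow> 'j \<Rightarrow> real \<Rightarrow> bool" where
  "argmin_compensation i j x \<longleftrightarrow> is_arg_min (\<lambda>y. P i j y * (y - c' i)) (\<lambda>y. 0 \<le> y) x"

end

end

theory Submission imports Defs begin

text \<open>
  An offered pair \<open>(i, j)\<close> contributes \<open>P i j x * (x - c' i) + c' i\<close> to the expected cost, where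
  \<open>x = C i j\<close>. Hence the compensations of the pairs of a fixed assignment can be optimized
  independently of each other, and only the finitely many assignments remain to be compared.
\<close>

context capcab
begin

lemma expected_cost_argmin_le:
  assumes "assignment A" and "compensation C'"
    and argmin: "\<And>i j. (i, j) \<in> A \<Longrightarrow> argmin_compensation i j (C i j)"
  shows "expected_cost A C \<le> expected_cost A C'"
proof -
  have "P i j (C i j) * C i j + (1 - P i j (C i j)) * c' i
      \<le> P i j (C' i j) * C' i j + (1 - P i j (C' i j)) * c' i" if "(i, j) \<in> A" for i j
  proof -
    have "0 \<le> C' i j"
      using assms(1,2) that by (auto simp: assignment_def compensation_def)
    then have "P i j (C i j) * (C i j - c' i) \<le> P i j (C' i j) * (C' i j - c' i)"
      using argmin[OF that] by (auto simp: argmin_compensation_def is_arg_min_linorder)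
    then show ?thesis
      by (simp add: algebra_simps)
  qed
  then show ?thesis
    unfolding expected_cost_def by (intro add_left_mono sum_mono) auto
qed

lemma finite_assignments: "finite {A. assignment A}"
  by (rule finite_subset[of _ "Pow (I \<times> J)"])
    (auto simp: assignment_def finite_I finite_J)

lemma ex_assignment_all_argmin_optimal:
  assumes M: "compensation M"
    and argmin: "\<And>i j. i \<in> I \<Longrightarrow> j \<in> J \<Longrightarrow> argmin_compensation i j (M i j)"
  shows "\<exists>A. assignment A \<and>
    (\<forall>C. compensation C \<and> (\<forall>(i, j)\<in>A. argmin_compensation i j (C i j)) \<longrightarrow> optimal A C)"
proof -
  have "assignment {}"
    by (simp add: assignment_def)
  then obtain A where A: "assignment A"
    and min: "\<And>B. assignment B \<Longrightarrow> expected_cost A M \<le> expected_cost B M"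
    using ex_min_if_finite[of "(\<lambda>A. expected_cost A M) ` {A. assignment A}"] finite_assignments
    by (fastforce simp: not_less)
  have "optimal A C"
    if C: "compensation C" and C_argmin: "\<forall>(i, j)\<in>A. argmin_compensation i j (C i j)" for C
    unfolding optimal_def
  proof (intro conjI allI impI)
    show "feasible A C"
      using A C by (simp add: feasible_def)
    fix B D assume "feasible B D"
    then have B: "assignment B" and D: "compensation D"
      by (auto simp: feasible_def)
    have "expected_cost A C \<le> expected_cost A M"
      using A M C_argmin by (auto intro: expected_cost_argmin_le)
    also have "\<dots> \<le> expected_cost B M"
      using B by (rule min)
    also have "\<dots> \<le> expected_cost B D"
      using B by (intro expected_cost_argmin_le D argmin) (auto simp: assignment_def)
    finally show "expected_cost A C \<le> expected_cost B D" .
  qed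
  with A show ?thesis
    by blast
qed

end

theorem theorem1:
  fixes I :: "'i set" and J :: "'j set"
    and c c' :: "'i \<Rightarrow> real"
    and P :: "'i \<Rightarrow> 'j \<Rightarrow> real \<Rightarrow> real"
  assumes "capcab I J c c' P"
    and "\<And>i j. i \<in> I \<Longrightarrow> j \<in> J \<Longrightarrow> \<exists>x. capcab.argmin_compensation c' P i j x"
  shows "\<exists>A C. capcab.optimal I J c c' P A C \<and>
           (\<forall>(i, j)\<in>A. capcab.argmin_compensation c' P i j (C i j)) \<and>
           (\<forall>C'. capcab.compensation I J C' \<and>
                 (\<forall>(i, j)\<in>A. capcab.argmin_compensation c' P i j (C' i j)) \<longrightarrow>
                 capcab.optimal I J c c' P A C')"
proof -
  interpret capcab I J c c' P
    by fact
  obtain M where M: "\<And>i j. i \<in> I \<Longrightarrow> j \<in> J \<Longrightarrow> argmin_compensation i j (M i j)"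
    using assms(2) by metis
  have comp: "compensation M"
    using M by (auto simp: compensation_def argmin_compensation_def is_arg_min_def)
  obtain A where A: "assignment A" and
    "\<forall>C. compensation C \<and> (\<forall>(i, j)\<in>A. argmin_compensation i j (C i j)) \<longrightarrow> optimal A C"
    using ex_assignment_all_argmin_optimal[OF comp M] by blast
  moreover have "\<forall>(i, j)\<in>A. argmin_compensation i j (M i j)"
    using A M by (auto simp: assignment_def)
  ultimately show ?thesis
    using comp by blast
qed

end
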